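(* Let $k\ge 2$. Then, as formal power series in $t$ with coefficients in $\mathbb{Q}(p,q,r,x)$, $$\sum_{n\ge 0}\frac{t^n}{[n]_{p,q}!}\sum_{(\sigma,w)\in C_k\wr S_n} q^{\mathrm{inv}(\sigma)}p^{\mathrm{coinv}(\sigma)}r^{\|w\|}x^{\mathrm{ris}(\sigma,w)}=\frac{1-x}{1-x+\sum_{n\ge 1}\frac{p^{\binom{n}{2}}((x-1)t)^n}{[n]_{p,q}!}\begin{bmatrix} n+k-1\\ n\end{bmatrix}_r}.$$
   Context: For $k\ge 2$, $n\ge 0$, the wreath product $C_k\wr S_n$ is identified with the set of pairs $(\sigma,w)$ with $\sigma=\sigma_1\cdots\sigma_n\in S_n$ and $w=w_1\cdots w_n\in\{0,1,\dots,k-1\}^n$ (for $n=0$ there is exactly one, empty, element). $\mathrm{inv}(\sigma)=|\{i<j:\sigma_i>\sigma_j\}|$, $\mathrm{coinv}(\sigma)=|\{i<j:\sigma_i<\sigma_j\}|$, $\|w\|=w_1+\cdots+w_n$. The rise statistic is $\mathrm{ris}(\sigma,w)=|\{i\in\{1,\dots,n-1\}:\sigma_i<\sigma_{i+1}\text{ and } w_i\le w_{i+1}\}|$. The $p,q$-analogues are $[n]_{p,q}=\frac{p^n-q^n}{p-q}=p^{n-1}+p^{n-2}q+\cdots+q^{n-1}$, $[n]_{p,q}!=[n]_{p,q}[n-1]_{p,q}\cdots[1]_{p,q}$ (with $[0]_{p,q}!=1$); $[n]_r=[n]_{1,r}=1+r+\cdots+r^{n-1}$, $[n]_r!=[n]_{1,r}!$,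 and $\begin{bmatrix} a\\ b\end{bmatrix}_r=\frac{[a]_r!}{[b]_r![a-b]_r!}$ for $0\le b\le a$ (and $0$ if $b>a$). *)

theory Defs
  imports
    "HOL-Computational_Algebra.Computational_Algebra"
    "HOL-Combinatorics.Permutations"
    "HOL-Library.FuncSet"
begin

text \<open>
  The coefficient field \<open>\<rat>(p,q,r,x)\<close> is the fraction field of \<open>\<rat>[p][q][r][x]\<close>; the indeterminate
  \<open>p\<close> lives in the innermost polynomial layer, \<open>x\<close> in the outermost one.
\<close>

type_synonym rat_pqrx = "rat poly poly poly poly fract"

definition var_p :: rat_pqrx where "var_p = Fract [:[:[:[:0, 1:]:]:]:] 1"
definition var_q :: rat_pqrx where "var_q = Fract [:[:[:0, 1:]:]:] 1"
definition var_r :: rat_pqrx where "var_r = Fract [:[:0, 1:]:] 1"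
definition var_x :: rat_pqrx where "var_x = Fract [:0, 1:] 1"

definition pq_int :: "'a::field \<Rightarrow> 'a \<Rightarrow> nat \<Rightarrow> 'a" where
  "pq_int p q n = (\<Sum>i<n. p ^ (n - 1 - i) * q ^ i)"

lemma pq_int_eq:
  assumes "p \<noteq> q"
  shows "pq_int p q n = (p ^ n - q ^ n) / (p - q)"
proof -
  have "q ^ n - p ^ n = (q - p) * pq_int p q n"
    by (simp add: power_diff_sumr2 pq_int_def)
  then have "p ^ n - q ^ n = (p - q) * pq_int p q n"
    by (simp add: algebra_simps)
  with assms show ?thesis by simp
qed

definition pq_fact :: "'a::field \<Rightarrow> 'a \<Rightarrow> nat \<Rightarrow> 'a" where
  "pq_fact p q n = (\<Prod>i=1..n. pq_int p q i)"

definition r_fact :: "'a::field \<Rightarrow> nat \<Rightarrow> 'a" where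
  "r_fact r n = pq_fact 1 r n"

definition r_binomial :: "'a::field \<Rightarrow> nat \<Rightarrow> nat \<Rightarrow> 'a" where
  "r_binomial r a b = (if b \<le> a then r_fact r a / (r_fact r b * r_fact r (a - b)) else 0)"

definition wreath :: "nat \<Rightarrow> nat \<Rightarrow> ((nat \<Rightarrow> nat) \<times> (nat \<Rightarrow> nat)) set" where
  "wreath k n = {\<sigma>. \<sigma> permutes {1..n}} \<times> ({1..n} \<rightarrow>\<^sub>E {0..<k})"

lemma finite_wreath: "finite (wreath k n)"
  by (simp add: wreath_def finite_permutations finite_PiE)

definition invs :: "nat \<Rightarrow> (nat \<Rightarrow> nat) \<Rightarrow> nat" where
  "invs n \<sigma> = card {(i, j). i \<in> {1..n} \<and> j \<in> {1..n} \<and> i < j \<and> \<sigma> i > \<sigma> j}"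

definition coinvs :: "nat \<Rightarrow> (nat \<Rightarrow> nat) \<Rightarrow> nat" where
  "coinvs n \<sigma> = card {(i, j). i \<in> {1..n} \<and> j \<in> {1..n} \<and> i < j \<and> \<sigma> i < \<sigma> j}"

definition wt :: "nat \<Rightarrow> (nat \<Rightarrow> nat) \<Rightarrow> nat" where
  "wt n w = (\<Sum>i=1..n. w i)"

definition ris :: "nat \<Rightarrow> (nat \<Rightarrow> nat) \<Rightarrow> (nat \<Rightarrow> nat) \<Rightarrow> nat" where
  "ris n \<sigma> w = card {i. 1 \<le> i \<and> i < n \<and> \<sigma> i < \<sigma> (i + 1) \<and> w i \<le> w (i + 1)}"

end

theory Submission
  imports Defs "HOL-Combinatorics.Multiset_Permutations"
begin

text \<open>
  Write \<open>N\<^sub>n\<close> for the inner sum. For a fixed \<open>(\<sigma>, w)\<close>, telescoping over the final run of rises gives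
  \<open>x^ris = \<Sum>\<^sub>j (x - 1)^(n - 1 - j) x^ris\<^sub>j\<close>, where \<open>j < n\<close> ranges over the positions after which
  every step is a rise and \<open>ris\<^sub>j\<close> counts the rises among the first \<open>j\<close> letters. Summing over
  \<open>C\<^sub>k \<wr> S\<^sub>n\<close>, the part of \<open>\<sigma>\<close> after position \<open>j\<close> is increasing, hence determined by the set of the first
  \<open>j\<close> values; these sets contribute a \<open>p,q\<close>-binomial coefficient, and the weakly increasing
  words of length \<open>n - j\<close> contribute an \<open>r\<close>-binomial coefficient. With \<open>m = n - j\<close> this is
  \<open>N\<^sub>n = \<Sum>\<^sub>m [n choose m]\<^sub>p\<^sub>,\<^sub>q p^(m choose 2) (x - 1)^(m - 1) [m + k - 1 choose m]\<^sub>r N\<^sub>n\<^sub>-\<^sub>m\<close>,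
  which is the claimed identity multiplied out.
\<close>

section \<open>The \<open>p,q\<close>-binomial coefficients and their Pascal rule\<close>

text \<open>The coefficient is indexed by its two lower parts, so \<open>pq_binom p q a b\<close> is \<open>[a + b choose a]\<^sub>p\<^sub>,\<^sub>q\<close>.\<close>

definition pq_binom :: "'a::field \<Rightarrow> 'a \<Rightarrow> nat \<Rightarrow> nat \<Rightarrow> 'a" where
  "pq_binom p q a b = pq_fact p q (a + b) / (pq_fact p q a * pq_fact p q b)"

text \<open>Cutting the sum after its first \<open>b\<close> terms leaves a common factor
  \<open>p ^ a\<close> in those terms and \<open>q ^ b\<close> in the other \<open>a\<close>. This
  splitting is what yields the Pascal rule below.\<close>

lemma pq_int_add:
  fixes p q :: "'a::field"
  shows "pq_int p q (a + b) = p ^ a * pq_int p q b + q ^ b * pq_int p q a"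
proof -
  have split: "(\<Sum>i<a + b. f i) = (\<Sum>i<b. f i) + (\<Sum>i<a. f (i + b))" for f :: "nat \<Rightarrow> 'a"
    by (induction a) (auto simp: add_ac)
  have "(\<Sum>i<a + b. p ^ (a + b - 1 - i) * q ^ i) =
      (\<Sum>i<b. p ^ (a + b - 1 - i) * q ^ i) + (\<Sum>i<a. p ^ (a + b - 1 - (i + b)) * q ^ (i + b))"
    by (rule split)
  also have "(\<Sum>i<b. p ^ (a + b - 1 - i) * q ^ i) = p ^ a * pq_int p q b"
    by (auto simp: pq_int_def sum_distrib_left mult.assoc[symmetric] power_add[symmetric] intro!: sum.cong)
  also have "(\<Sum>i<a. p ^ (a + b - 1 - (i + b)) * q ^ (i + b)) = q ^ b * pq_int p q a"
    by (auto simp: pq_int_def sum_distrib_left power_add mult_ac intro!: sum.cong)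
  finally show ?thesis by (simp add: pq_int_def)
qed

lemma pq_fact_0 [simp]: "pq_fact p q 0 = 1"
  by (simp add: pq_fact_def)

lemma pq_fact_Suc: "pq_fact p q (Suc n) = pq_int p q (Suc n) * pq_fact p q n"
  by (simp add: pq_fact_def prod.nat_ivl_Suc')

lemma pq_binom_Suc_Suc:
  assumes "\<And>n. pq_fact p q n \<noteq> 0"
  shows "pq_binom p q (Suc a) (Suc b) =
    p ^ Suc a * pq_binom p q (Suc a) b + q ^ Suc b * pq_binom p q a (Suc b)"
proof -
  \<comment> \<open>Each \<open>pq_int\<close> with positive index is a factor of a nonzero
    factorial, so it may be cancelled.\<close>
  have "pq_int p q n \<noteq> 0" if "n > 0" for n
    using assms[of n] that by (cases n) (auto simp: pq_fact_Suc)
  then have nz: "pq_int p q (Suc n) \<noteq> 0" for n by simp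
  have "pq_fact p q (Suc a + Suc b) = pq_int p q (Suc a + Suc b) * pq_fact p q (Suc (a + b))"
    by (simp add: pq_fact_Suc)
  then have "pq_fact p q (Suc a + Suc b) =
      (p ^ Suc a * pq_int p q (Suc b) + q ^ Suc b * pq_int p q (Suc a)) * pq_fact p q (Suc (a + b))"
    by (simp only: pq_int_add)
  moreover have "Suc a + b = Suc (a + b)" "a + Suc b = Suc (a + b)" by auto
  ultimately show ?thesis
    unfolding pq_binom_def using assms[of a] assms[of b] nz[of a] nz[of b]
    by (simp only: pq_fact_Suc[of _ _ a] pq_fact_Suc[of _ _ b]) (simp add: field_simps)
qed

lemma pq_binom_0 [simp]:
  assumes "\<And>n. pq_fact p q n \<noteq> 0"
  shows "pq_binom p q a 0 = 1" "pq_binom p q 0 b = 1"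
  using assms by (simp_all add: pq_binom_def)

section \<open>Weakly increasing words and the \<open>r\<close>-binomial coefficient\<close>

definition sorted_words :: "nat \<Rightarrow> nat \<Rightarrow> nat list set" where
  "sorted_words k m = {ws. set ws \<subseteq> {..<k} \<and> length ws = m \<and> sorted ws}"

definition words :: "nat \<Rightarrow> nat \<Rightarrow> nat list set" where
  "words k m = {ws. set ws \<subseteq> {..<k} \<and> length ws = m}"

lemma finite_words [simp]: "finite (words k m)"
  unfolding words_def by (rule finite_lists_length_eq) simp

lemma finite_sorted_words [simp]: "finite (sorted_words k m)"
  by (rule finite_subset[OF _ finite_words[of k m]]) (auto simp: words_def sorted_words_def)

text \<open>A sorted word either avoids the largest letter \<open>k\<close> or ends with it.\<close>

lemma sorted_words_Suc_Suc:
  "sorted_words (Suc k) (Suc m) = sorted_words k (Suc m) \<union> (\<lambda>ws. ws @ [k]) ` sorted_words (Suc k) m"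
proof (intro equalityI subsetI)
  fix ws assume ws: "ws \<in> sorted_words (Suc k) (Suc m)"
  then obtain vs v where v: "ws = vs @ [v]"
    by (cases ws rule: rev_cases) (auto simp: sorted_words_def)
  show "ws \<in> sorted_words k (Suc m) \<union> (\<lambda>ws. ws @ [k]) ` sorted_words (Suc k) m"
  proof (cases "v = k")
    case True
    with ws v show ?thesis by (auto simp: sorted_words_def sorted_append)
  next
    case False
    with ws v show ?thesis
      by (fastforce simp: sorted_words_def sorted_append)
  qed
qed (fastforce simp: sorted_words_def sorted_append lessThan_Suc)

lemma sum_sorted_words_Suc_Suc:
  fixes r :: "'a::field"
  shows "(\<Sum>ws\<in>sorted_words (Suc k) (Suc m). r ^ sum_list ws) =
    (\<Sum>ws\<in>sorted_words k (Suc m). r ^ sum_list ws) + r ^ k * (\<Sum>ws\<in>sorted_words (Suc k) m. r ^ sum_list ws)"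
proof -
  have "sorted_words k (Suc m) \<inter> (\<lambda>ws. ws @ [k]) ` sorted_words (Suc k) m = {}"
    by (auto simp: sorted_words_def)
  then show ?thesis
    by (simp add: sorted_words_Suc_Suc sum.union_disjoint sum.reindex inj_on_def power_add
        sum_distrib_left mult.commute)
qed

text \<open>Splitting off the largest letter gives exactly the Pascal rule of
  \<open>pq_binom\<close> at \<open>p = 1\<close>. The outer induction is on the alphabet, the inner
  one on the length; over the one-letter alphabet only the zero word remains.\<close>

lemma sum_sorted_words:
  fixes r :: "'a::field"
  assumes "\<And>n. pq_fact 1 r n \<noteq> 0"
  shows "(\<Sum>ws\<in>sorted_words (Suc k) m. r ^ sum_list ws) = pq_binom 1 r m k"
proof (induction k arbitrary: m)
  case 0
  have emp: "sorted_words 0 (Suc m) = {}" for m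
    by (auto simp: sorted_words_def)
  show ?case
  proof (induction m)
    case 0
    have "sorted_words (Suc 0) 0 = {[]}" by (auto simp: sorted_words_def)
    then show ?case using assms by simp
  next
    case (Suc m)
    then show ?case using assms by (simp add: sum_sorted_words_Suc_Suc emp)
  qed
next
  case (Suc k)
  note IH = this
  show ?case
  proof (induction m)
    case 0
    have "sorted_words (Suc (Suc k)) 0 = {[]}" by (auto simp: sorted_words_def)
    then show ?case using assms by simp
  next
    case (Suc m)
    then show ?case using assms IH
      by (simp add: sum_sorted_words_Suc_Suc[of r "Suc k"] pq_binom_Suc_Suc)
  qed
qed

section \<open>Inversions and coinversions of lists, and their behaviour under concatenation\<close>

primrec rel_pairs :: "(nat \<Rightarrow> nat \<Rightarrow> bool) \<Rightarrow> nat list \<Rightarrow> nat" where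
  "rel_pairs R [] = 0"
| "rel_pairs R (u # us) = length (filter (R u) us) + rel_pairs R us"

definition cross :: "(nat \<Rightarrow> nat \<Rightarrow> bool) \<Rightarrow> nat set \<Rightarrow> nat set \<Rightarrow> nat" where
  "cross R A B = (\<Sum>a\<in>A. card {b\<in>B. R a b})"

text \<open>A pair straddling the cut is counted whatever the order inside the two halves, so its
  contribution depends only on the two sets of entries. Distinctness turns counts of list entries
  into cardinalities.\<close>

lemma rel_pairs_append:
  assumes "distinct us" "distinct vs"
  shows "rel_pairs R (us @ vs) = rel_pairs R us + rel_pairs R vs + cross R (set us) (set vs)"
  using assms by (induction us) (auto simp: cross_def distinct_length_filter Int_def conj_commute)

lemma rel_pairs_sorted_greater: "sorted us \<Longrightarrow> rel_pairs (>) us = 0"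
  by (induction us) (auto simp: filter_empty_conv not_less)

text \<open>Every pair of positions of an increasing list is a coinversion; this is the source of
  the power \<open>p ^ (m choose 2)\<close>.\<close>

lemma rel_pairs_strict_sorted_less:
  "sorted_wrt (<) us \<Longrightarrow> rel_pairs (<) us = length us choose 2"
  by (induction us) (auto simp: numeral_2_eq_2 filter_id_conv cong: filter_cong)

lemma rel_pairs_map:
  assumes "strict_mono_on A f" "set us \<subseteq> A"
  shows "rel_pairs (<) (map f us) = rel_pairs (<) us" "rel_pairs (>) (map f us) = rel_pairs (>) us"
proof -
  have less: "f u < f v \<longleftrightarrow> u < v" if "u \<in> A" "v \<in> A" for u v
    using strict_mono_on_less[OF assms(1)] that by blast
  have "length (filter (\<lambda>v. f u < f v) vs) = length (filter (\<lambda>v. u < v) vs)"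
       "length (filter (\<lambda>v. f v < f u) vs) = length (filter (\<lambda>v. v < u) vs)"
    if "u \<in> A" "set vs \<subseteq> A" for u vs
    using that less by (auto intro!: arg_cong[where f = length] filter_cong)
  with assms(2) show "rel_pairs (<) (map f us) = rel_pairs (<) us" "rel_pairs (>) (map f us) = rel_pairs (>) us"
    by (induction us) (auto simp: filter_map o_def)
qed

section \<open>The \<open>p,q\<close>-binomial coefficient as a weighted count of subsets\<close>

definition subsets_card :: "nat \<Rightarrow> nat \<Rightarrow> nat set set" where
  "subsets_card n j = {S. S \<subseteq> {..<n} \<and> card S = j}"

lemma subsets_card_Suc_Suc:
  "subsets_card (Suc n) (Suc j) = subsets_card n (Suc j) \<union> insert n ` subsets_card n j"
proof (intro equalityI subsetI)
  fix S assume S: "S \<in> subsets_card (Suc n) (Suc j)"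
  then have fin: "finite S" by (auto simp: subsets_card_def intro: finite_subset)
  show "S \<in> subsets_card n (Suc j) \<union> insert n ` subsets_card n j"
  proof (cases "n \<in> S")
    case True
    with S fin have "S - {n} \<in> subsets_card n j" "S = insert n (S - {n})"
      by (auto simp: subsets_card_def lessThan_Suc)
    then show ?thesis by blast
  next
    case False
    with S show ?thesis by (auto simp: subsets_card_def lessThan_Suc)
  qed
next
  fix S assume "S \<in> subsets_card n (Suc j) \<union> insert n ` subsets_card n j"
  then consider "S \<in> subsets_card n (Suc j)" | T where "S = insert n T" "T \<subseteq> {..<n}" "card T = j"
    by (auto simp: subsets_card_def)
  then show "S \<in> subsets_card (Suc n) (Suc j)"
  proof cases
    case 2
    moreover have "finite T" "n \<notin> T" using 2 by (auto intro: finite_subset)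
    ultimately show ?thesis by (auto simp: subsets_card_def)
  qed (auto simp: subsets_card_def)
qed

lemma finite_subsets_card [simp]: "finite (subsets_card n j)"
  by (simp add: subsets_card_def)

text \<open>With \<open>A\<close> the values before a cut and \<open>B\<close> those after it, this
  is the weight of the inversions and coinversions across the cut.\<close>

definition cross_weight :: "'a::field \<Rightarrow> 'a \<Rightarrow> nat set \<Rightarrow> nat set \<Rightarrow> 'a" where
  "cross_weight p q A B = q ^ cross (>) A B * p ^ cross (<) A B"

lemma cross_insert_left:
  assumes "finite A" "a \<notin> A"
  shows "cross R (insert a A) B = card {b\<in>B. R a b} + cross R A B"
  using assms by (simp add: cross_def)

lemma cross_insert_right:
  assumes "finite A" "finite B" "b \<notin> B"
  shows "cross R A (insert b B) = card {a\<in>A. R a b} + cross R A B"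
proof -
  have "{b'\<in>insert b B. R a b'} = (if R a b then insert b {b'\<in>B. R a b'} else {b'\<in>B. R a b'})" for a
    by auto
  then have "cross R A (insert b B) = (\<Sum>a\<in>A. (if R a b then 1 else 0) + card {b'\<in>B. R a b'})"
    unfolding cross_def using assms by (intro sum.cong) auto
  then show ?thesis using assms
    by (simp add: sum.distrib cross_def sum.If_cases Int_def)
qed

text \<open>Induction on the size of the ground set, according to where its largest element lies. If
  it lies in the complement, it forms a coinversion with each of the \<open>j\<close> elements of
  \<open>S\<close>, giving \<open>p ^ j\<close>; if it lies in \<open>S\<close>, it forms an
  inversion with each of the \<open>m\<close> elements of the complement, giving
  \<open>q ^ m\<close>. These are the two terms of \<open>pq_binom_Suc_Suc\<close>.\<close>

lemma sum_cross_weight: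
  fixes p q :: "'a::field"
  assumes "\<And>n. pq_fact p q n \<noteq> 0"
  shows "(\<Sum>S\<in>subsets_card (j + m) j. cross_weight p q S ({..<j + m} - S)) = pq_binom p q j m"
proof (induction "j + m" arbitrary: j m)
  case 0
  have "subsets_card 0 0 = {{}}" by (auto simp: subsets_card_def)
  then show ?case using assms 0 by (simp add: cross_weight_def cross_def)
next
  case (Suc n)
  show ?case
  proof (cases j)
    case 0
    have "subsets_card (0 + m) 0 = {{}}"
      by (auto simp: subsets_card_def dest: finite_subset)
    then show ?thesis using assms 0 by (simp add: cross_weight_def cross_def)
  next
    case j: (Suc j')
    show ?thesis
    proof (cases m)
      case 0
      have "subsets_card (j + 0) j = {{..<j}}"
        using card_subset_eq[OF finite_lessThan[of j]] by (auto simp: subsets_card_def)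
      then show ?thesis using assms 0 by (simp add: cross_weight_def cross_def)
    next
      case m: (Suc m')
      have n: "n = j' + Suc m'" "n = Suc j' + m'" using Suc.hyps(2) j m by auto
      have disj: "subsets_card n (Suc j') \<inter> insert n ` subsets_card n j' = {}"
        by (auto simp: subsets_card_def)
      have inj: "inj_on (insert n) (subsets_card n j')"
        by (auto simp: subsets_card_def inj_on_def)
      have 1: "cross_weight p q S ({..<Suc n} - S) = p ^ Suc j' * cross_weight p q S ({..<n} - S)"
        if S: "S \<in> subsets_card n (Suc j')" for S
      proof -
        have fin: "finite S" "n \<notin> S" using S by (auto simp: subsets_card_def intro: finite_subset)
        have e: "{..<Suc n} - S = insert n ({..<n} - S)" using fin by auto
        have "{a\<in>S. a < n} = S" "{a\<in>S. n < a} = {}" using S by (auto simp: subsets_card_def)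
        then have "card {a\<in>S. a < n} = Suc j'" "card {a\<in>S. n < a} = 0"
          using S by (simp_all only: subsets_card_def mem_Collect_eq card.empty)
        moreover have "cross R S ({..<Suc n} - S) = card {a\<in>S. R a n} + cross R S ({..<n} - S)" for R
          unfolding e using fin by (intro cross_insert_right) auto
        ultimately have "cross (<) S ({..<Suc n} - S) = Suc j' + cross (<) S ({..<n} - S)"
            "cross (>) S ({..<Suc n} - S) = cross (>) S ({..<n} - S)"
          by (simp_all only: add_0)
        then show ?thesis by (simp add: cross_weight_def power_add)
      qed
      have 2: "cross_weight p q (insert n S) ({..<Suc n} - insert n S) = q ^ Suc m' * cross_weight p q S ({..<n} - S)"
        if S: "S \<in> subsets_card n j'" for S
      proof -
        have fin: "finite S" "n \<notin> S" using S by (auto simp: subsets_card_def intro: finite_subset)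
        have e: "{..<Suc n} - insert n S = {..<n} - S" using fin by auto
        have "{a\<in>{..<n} - S. a < n} = {..<n} - S" "{a\<in>{..<n} - S. n < a} = {}" by auto
        moreover have "card ({..<n} - S) = Suc m'"
          using S fin n by (simp add: subsets_card_def card_Diff_subset)
        ultimately have "card {a\<in>{..<n} - S. a < n} = Suc m'" "card {a\<in>{..<n} - S. n < a} = 0"
          by (simp_all only: card.empty)
        moreover have "cross R (insert n S) ({..<n} - S) = card {a\<in>{..<n} - S. R n a} + cross R S ({..<n} - S)" for R
          using fin by (rule cross_insert_left)
        ultimately have "cross (>) (insert n S) ({..<n} - S) = Suc m' + cross (>) S ({..<n} - S)"
            "cross (<) (insert n S) ({..<n} - S) = cross (<) S ({..<n} - S)"
          by (simp_all only: add_0)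
        then show ?thesis by (simp add: e cross_weight_def power_add)
      qed
      have "(\<Sum>S\<in>subsets_card (Suc n) (Suc j'). cross_weight p q S ({..<Suc n} - S)) =
          p ^ Suc j' * (\<Sum>S\<in>subsets_card n (Suc j'). cross_weight p q S ({..<n} - S)) +
          q ^ Suc m' * (\<Sum>S\<in>subsets_card n j'. cross_weight p q S ({..<n} - S))"
        by (simp add: subsets_card_Suc_Suc sum.union_disjoint[OF _ _ disj] sum.reindex[OF inj] 1 2
            sum_distrib_left del: power_Suc)
      also have "(\<Sum>S\<in>subsets_card n (Suc j'). cross_weight p q S ({..<n} - S)) = pq_binom p q (Suc j') m'"
        using Suc.hyps(1)[OF n(2)] n(2) by simp
      also have "(\<Sum>S\<in>subsets_card n j'. cross_weight p q S ({..<n} - S)) = pq_binom p q j' (Suc m')"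
        using Suc.hyps(1)[OF n(1)] n(1) by simp
      finally show ?thesis using assms j m n by (simp add: pq_binom_Suc_Suc)
    qed
  qed
qed

section \<open>Telescoping \<open>x ^ ris\<close> over the final run of rises\<close>

definition list_ris :: "nat list \<Rightarrow> nat list \<Rightarrow> nat" where
  "list_ris us ws = card {i. Suc i < length us \<and> us ! i < us ! Suc i \<and> ws ! i \<le> ws ! Suc i}"

text \<open>Induction on \<open>n\<close>. If the new last step satisfies \<open>P\<close>, every
  old summand gains a factor \<open>x - 1\<close> and the new summand \<open>j = n\<close> adds the
  old power once more, which totals \<open>x\<close> times the old power. Otherwise only the new
  summand survives. The step from position \<open>j - 1\<close> to \<open>j\<close> is neither
  constrained nor counted.\<close>

lemma power_card_runs:
  fixes x :: "'a::field"
  assumes "n \<ge> 1"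
  shows "x ^ card {i. Suc i < n \<and> P i} =
    (\<Sum>j<n. if \<forall>i. j \<le> i \<and> Suc i < n \<longrightarrow> P i
            then (x - 1) ^ (n - 1 - j) * x ^ card {i. Suc i < j \<and> P i} else 0)"
  using assms
proof (induction n rule: nat_induct_at_least)
  case base
  show ?case by simp
next
  case (Suc n)
  let ?R = "\<lambda>j. card {i. Suc i < j \<and> P i}"
  \<comment> \<open>For \<open>j < n\<close> the new step, with index \<open>n - 1\<close>, belongs
    to the tail, so its condition can be split off.\<close>
  have all: "(\<forall>i. j \<le> i \<and> Suc i < Suc n \<longrightarrow> P i) \<longleftrightarrow> P (n - 1) \<and> (\<forall>i. j \<le> i \<and> Suc i < n \<longrightarrow> P i)"
    if "j < n" for j
  proof -
    from that obtain n' where "n = Suc n'" by (cases n) auto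
    then show ?thesis using \<open>j < n\<close> by (auto simp: less_Suc_eq)
  qed
  have "(\<Sum>j<n. if \<forall>i. j \<le> i \<and> Suc i < Suc n \<longrightarrow> P i then (x - 1) ^ (n - j) * x ^ ?R j else 0) =
      (\<Sum>j<n. (if P (n - 1) then x - 1 else 0) *
        (if \<forall>i. j \<le> i \<and> Suc i < n \<longrightarrow> P i then (x - 1) ^ (n - 1 - j) * x ^ ?R j else 0))"
  proof (intro sum.cong refl)
    fix j assume "j \<in> {..<n}"
    then have "j < n" by simp
    have "n - j = Suc (n - 1 - j)" using \<open>j < n\<close> by simp
    then have "(x - 1) ^ (n - j) = (x - 1) * (x - 1) ^ (n - 1 - j)"
      by (simp only: power_Suc)
    then show "(if \<forall>i. j \<le> i \<and> Suc i < Suc n \<longrightarrow> P i then (x - 1) ^ (n - j) * x ^ ?R j else 0) =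
       (if P (n - 1) then x - 1 else 0) *
        (if \<forall>i. j \<le> i \<and> Suc i < n \<longrightarrow> P i then (x - 1) ^ (n - 1 - j) * x ^ ?R j else 0)"
      unfolding all[OF \<open>j < n\<close>] by auto
  qed
  also have "\<dots> = (if P (n - 1) then x - 1 else 0) * x ^ ?R n"
    by (simp only: Suc.IH sum_distrib_left)
  finally have *: "(\<Sum>j<n. if \<forall>i. j \<le> i \<and> Suc i < Suc n \<longrightarrow> P i then (x - 1) ^ (n - j) * x ^ ?R j else 0) =
      (if P (n - 1) then x - 1 else 0) * x ^ ?R n" .
  have "{i. Suc i < Suc n \<and> P i} = (if P (n - 1) then insert (n - 1) {i. Suc i < n \<and> P i} else {i. Suc i < n \<and> P i})"
    using Suc.hyps by (auto simp: less_Suc_eq)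
  moreover have "finite {i. Suc i < n \<and> P i}"
    by (rule finite_subset[of _ "{..<n}"]) auto
  ultimately have "?R (Suc n) = (if P (n - 1) then Suc (?R n) else ?R n)"
    using Suc.hyps by auto
  then show ?case unfolding diff_Suc_1 using * by (simp add: algebra_simps) auto
qed

section \<open>Weighted sums over an arbitrary set of values\<close>

definition list_weight :: "'a::field \<Rightarrow> 'a \<Rightarrow> 'a \<Rightarrow> 'a \<Rightarrow> nat list \<Rightarrow> nat list \<Rightarrow> 'a" where
  "list_weight p q r x us ws =
    q ^ rel_pairs (>) us * p ^ rel_pairs (<) us * r ^ sum_list ws * x ^ list_ris us ws"

text \<open>The value set \<open>V\<close> is arbitrary because cutting a permutation leaves a
  prefix whose values form an arbitrary set of the right size.\<close>

definition wreath_sum :: "'a::field \<Rightarrow> 'a \<Rightarrow> 'a \<Rightarrow> 'a \<Rightarrow> nat \<Rightarrow> nat set \<Rightarrow> 'a" where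
  "wreath_sum p q r x k V =
    (\<Sum>(us, ws)\<in>permutations_of_set V \<times> words k (card V). list_weight p q r x us ws)"

text \<open>All statistics see only the relative order of the values, so the increasing bijection
  from \<open>{..<card V}\<close> to \<open>V\<close> preserves every weight; the words are left
  alone.\<close>

lemma wreath_sum_card:
  assumes "finite V"
  shows "wreath_sum p q r x k V = wreath_sum p q r x k {..<card V}"
proof -
  obtain h where h: "bij_betw h {..<card V} V" and mono: "strict_mono_on {..<card V} h"
    using ex_bij_betw_strict_mono_card[OF assms] .
  have inj: "inj_on h {..<card V}" and V: "V = h ` {..<card V}"
    using h by (auto simp: bij_betw_def)
  have less: "h u < h v \<longleftrightarrow> u < v" if "u < card V" "v < card V" for u v
    using strict_mono_on_less[OF mono] that by simp
  have perms: "permutations_of_set V = map h ` permutations_of_set {..<card V}"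
    using permutations_of_set_image_inj[OF inj] by (simp only: V[symmetric])
  have inj_map: "inj_on (map h) (permutations_of_set {..<card V})"
  proof (rule inj_onI)
    fix us vs assume "us \<in> permutations_of_set {..<card V}" "vs \<in> permutations_of_set {..<card V}"
      and eq: "map h us = map h vs"
    then have "set us \<union> set vs = {..<card V}" by (simp add: permutations_of_set_def)
    then have "inj_on h (set us \<union> set vs)" using inj by (simp only:)
    with eq show "us = vs" by (rule map_inj_on)
  qed
  have weight: "list_weight p q r x (map h us) ws = list_weight p q r x us ws"
    if "us \<in> permutations_of_set {..<card V}" for us ws
  proof -
    have us: "set us = {..<card V}" using permutations_of_setD[OF that] by simp
    have "us ! i < card V" if "i < length us" for i
      using nth_mem[OF that] us by simp
    then have "list_ris (map h us) ws = list_ris us ws"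
      by (simp add: list_ris_def less cong: conj_cong)
    then show ?thesis
      unfolding list_weight_def using rel_pairs_map[OF mono] us by simp
  qed
  show ?thesis
    unfolding wreath_sum_def perms sum.cartesian_product[symmetric]
    by (simp add: sum.reindex[OF inj_map] weight)
qed

section \<open>Splitting off an increasing tail, and the recurrence\<close>

lemma list_ris_append_take:
  assumes "length us = length ws"
  shows "list_ris us ws = card {i. Suc i < length us \<and> ((us @ us') ! i < (us @ us') ! Suc i \<and> (ws @ ws') ! i \<le> (ws @ ws') ! Suc i)}"
  unfolding list_ris_def using assms
  by (auto intro!: arg_cong[where f = card] simp: nth_append)

text \<open>By transitivity, sortedness of a list is a condition on adjacent entries, so a tail made
  up of rises is one where both lists are sorted.\<close>

lemma sorted_drop_iff:
  fixes us ws :: "nat list"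
  assumes "length us = n" "length ws = n"
  shows "(\<forall>i. j \<le> i \<and> Suc i < n \<longrightarrow> us ! i < us ! Suc i \<and> ws ! i \<le> ws ! Suc i) \<longleftrightarrow>
    sorted_wrt (<) (drop j us) \<and> sorted (drop j ws)" (is "?L \<longleftrightarrow> ?R")
proof -
  have "?R \<longleftrightarrow> (\<forall>i. Suc i < n - j \<longrightarrow> us ! (j + i) < us ! Suc (j + i) \<and> ws ! (j + i) \<le> ws ! Suc (j + i))"
    using assms by (auto simp: sorted_wrt_iff_nth_Suc_transp sorted_iff_nth_Suc)
  also have "\<dots> \<longleftrightarrow> ?L"
  proof (intro iffI allI impI)
    fix i assume *: "\<forall>i. Suc i < n - j \<longrightarrow> us ! (j + i) < us ! Suc (j + i) \<and> ws ! (j + i) \<le> ws ! Suc (j + i)"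
      and i: "j \<le> i \<and> Suc i < n"
    from i have "Suc (i - j) < n - j" by linarith
    with i show "us ! i < us ! Suc i \<and> ws ! i \<le> ws ! Suc i"
      using spec[OF *, of "i - j"] by simp
  qed auto
  finally show ?thesis ..
qed

definition tail_sorted_pairs :: "nat \<Rightarrow> nat \<Rightarrow> nat \<Rightarrow> (nat list \<times> nat list) set" where
  "tail_sorted_pairs k n j = {(us, ws). us \<in> permutations_of_set {..<n} \<and> ws \<in> words k n \<and>
     sorted_wrt (<) (drop j us) \<and> sorted (drop j ws)}"

text \<open>Only the power of \<open>x\<close> is expanded; the exponents of \<open>q\<close>,
  \<open>p\<close> and \<open>r\<close> still refer to the whole pair and are split later.\<close>

lemma list_weight_runs:
  fixes x :: "'a::field"
  assumes "length us = n" "length ws = n" "n \<ge> 1"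
  shows "list_weight p q r x us ws =
    (\<Sum>j<n. if sorted_wrt (<) (drop j us) \<and> sorted (drop j ws)
       then (x - 1) ^ (n - 1 - j) *
         (q ^ rel_pairs (>) us * p ^ rel_pairs (<) us * r ^ sum_list ws * x ^ list_ris (take j us) (take j ws))
       else 0)"
proof -
  let ?P = "\<lambda>i. us ! i < us ! Suc i \<and> ws ! i \<le> ws ! Suc i"
  have take: "card {i. Suc i < j \<and> ?P i} = list_ris (take j us) (take j ws)" if "j < n" for j
    using list_ris_append_take[of "take j us" "take j ws" "drop j us" "drop j ws"] assms that by simp
  have "x ^ list_ris us ws = (\<Sum>j<n. if \<forall>i. j \<le> i \<and> Suc i < n \<longrightarrow> ?P i
      then (x - 1) ^ (n - 1 - j) * x ^ card {i. Suc i < j \<and> ?P i} else 0)"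
    unfolding list_ris_def assms(1) by (rule power_card_runs) fact
  also have "\<dots> = (\<Sum>j<n. if sorted_wrt (<) (drop j us) \<and> sorted (drop j ws)
      then (x - 1) ^ (n - 1 - j) * x ^ list_ris (take j us) (take j ws) else 0)"
    unfolding sorted_drop_iff[OF assms(1,2)] using take by (intro sum.cong) auto
  finally show ?thesis
    unfolding list_weight_def by (auto simp: sum_distrib_left intro!: sum.cong)
qed

text \<open>A pair with sorted tails amounts to the set \<open>S\<close> of its first
  \<open>j\<close> values, an arrangement of \<open>S\<close>, a word of length \<open>j\<close> and
  a sorted word of length \<open>n - j\<close>. The weight factors accordingly: pairs across the
  cut, coinversions of the tail, letters of the tail, and the weight of the prefix.\<close>

lemma tail_sorted_sum:
  fixes p q r x :: "'a::field"
  assumes "j \<le> n" and nz: "\<And>n. pq_fact p q n \<noteq> 0"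
  shows "(\<Sum>(us, ws)\<in>tail_sorted_pairs k n j.
      q ^ rel_pairs (>) us * p ^ rel_pairs (<) us * r ^ sum_list ws * x ^ list_ris (take j us) (take j ws)) =
    pq_binom p q j (n - j) * p ^ ((n - j) choose 2) *
      (\<Sum>ws\<in>sorted_words k (n - j). r ^ sum_list ws) * wreath_sum p q r x k {..<j}"
    (is "?lhs = _")
proof -
  let ?srt = "\<lambda>S. sorted_list_of_set ({..<n} - S)"
  let ?I = "SIGMA S:subsets_card n j. (permutations_of_set S \<times> words k j) \<times> sorted_words k (n - j)"
  \<comment> \<open>\<open>?f\<close> glues a prefix to the increasing list of the remaining values,
    and \<open>?g\<close> cuts after position \<open>j\<close>.\<close>
  let ?f = "\<lambda>(S, (us, ws), vs). (us @ ?srt S, ws @ vs)"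
  let ?g = "\<lambda>(us, ws). (set (take j us), (take j us, take j ws), drop j ws)"
  let ?w = "\<lambda>(S, (us, ws), vs). cross_weight p q S ({..<n} - S) * p ^ ((n - j) choose 2) * r ^ sum_list vs * list_weight p q r x us ws"
  have S: "finite S" "S \<subseteq> {..<n}" "card S = j" "card ({..<n} - S) = n - j"
    if "S \<in> subsets_card n j" for S
    using that by (auto simp: subsets_card_def card_Diff_subset finite_subset)
  have "?lhs = (\<Sum>a\<in>?I. ?w a)"
  proof (rule sum.reindex_bij_witness[of _ ?f ?g])
    fix a assume "a \<in> tail_sorted_pairs k n j"
    then obtain us ws where a: "a = (us, ws)" and us: "set us = {..<n}" "distinct us" "sorted_wrt (<) (drop j us)"
      and ws: "set ws \<subseteq> {..<k}" "length ws = n" "sorted (drop j ws)"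
      by (auto simp: tail_sorted_pairs_def permutations_of_set_def words_def)
    have len: "length us = n" using us distinct_card[of us] by simp
    have split: "set (take j us) \<union> set (drop j us) = {..<n}"
      using us(1) set_append[of "take j us" "drop j us"] by simp
    have disj: "set (take j us) \<inter> set (drop j us) = {}"
      using us(2) by (rule set_take_disj_set_drop_if_distinct) simp
    have "set (drop j us) = {..<n} - set (take j us)"
      using split disj by auto
    \<comment> \<open>A strictly increasing list is determined by its set of entries, so the tail
      carries no information beyond \<open>S\<close>.\<close>
    then have srt: "?srt (set (take j us)) = drop j us"
      using us(3) by (metis sorted_list_of_set.idem_if_sorted_distinct strict_sorted_iff)
    have card: "card (set (take j us)) = j"
      using us(2) len assms(1) by (simp add: distinct_card)
    show "?f (?g a) = a" using srt a by simp
    show "?g a \<in> ?I"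
      using a us ws len card assms(1) split
      by (auto simp: subsets_card_def permutations_of_set_def words_def sorted_words_def
          dest: in_set_takeD in_set_dropD)
    have dd: "set (drop j us) = {..<n} - set (take j us)" by fact
    have "rel_pairs R us = rel_pairs R (take j us) + rel_pairs R (drop j us) +
        cross R (set (take j us)) ({..<n} - set (take j us))" for R
      using rel_pairs_append[of "take j us" "drop j us" R] us(2) dd by simp
    moreover have "rel_pairs (>) (drop j us) = 0"
      using us(3) by (intro rel_pairs_sorted_greater) (simp add: strict_sorted_imp_sorted)
    moreover have "rel_pairs (<) (drop j us) = (n - j) choose 2"
      using rel_pairs_strict_sorted_less[OF us(3)] len by simp
    moreover have "sum_list ws = sum_list (take j ws) + sum_list (drop j ws)"
      by (metis append_take_drop_id sum_list_append)
    ultimately show "?w (?g a) = (case a of (us, ws) \<Rightarrow>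
        q ^ rel_pairs (>) us * p ^ rel_pairs (<) us * r ^ sum_list ws * x ^ list_ris (take j us) (take j ws))"
      by (simp add: a list_weight_def cross_weight_def power_add mult_ac)
  next
    fix b assume "b \<in> ?I"
    then obtain T us ws vs where b: "b = (T, (us, ws), vs)" and T: "T \<in> subsets_card n j"
      and us: "set us = T" "distinct us" and ws: "set ws \<subseteq> {..<k}" "length ws = j"
      and vs: "set vs \<subseteq> {..<k}" "length vs = n - j" "sorted vs"
      by (auto simp: permutations_of_set_def words_def sorted_words_def)
    have len: "length us = j" using us S[OF T] distinct_card[of us] by simp
    show "?g (?f b) = b" using b len ws us by simp
    show "?f b \<in> tail_sorted_pairs k n j"
      using b len ws us vs S[OF T] assms(1)
      by (auto simp: tail_sorted_pairs_def permutations_of_set_def words_def)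
  qed
  also have "\<dots> = (\<Sum>S\<in>subsets_card n j. \<Sum>((us, ws), vs)\<in>(permutations_of_set S \<times> words k j) \<times> sorted_words k (n - j).
      ?w (S, (us, ws), vs))"
    by (subst sum.Sigma) (auto simp: case_prod_beta intro!: sum.cong)
  also have "\<dots> = (\<Sum>S\<in>subsets_card n j. cross_weight p q S ({..<n} - S) * (p ^ ((n - j) choose 2) *
      (\<Sum>ws\<in>sorted_words k (n - j). r ^ sum_list ws) * wreath_sum p q r x k {..<j}))"
  proof (intro sum.cong refl)
    fix T assume T: "T \<in> subsets_card n j"
    \<comment> \<open>The prefix sum is the same for every \<open>T\<close> of size
      \<open>j\<close>, so it leaves the sum over subsets.\<close>
    have W: "wreath_sum p q r x k {..<j} = (\<Sum>(us, ws)\<in>permutations_of_set T \<times> words k j. list_weight p q r x us ws)"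
      using wreath_sum_card[of T p q r x k] S[OF T] by (simp add: wreath_sum_def)
    have "(\<Sum>((us, ws), vs)\<in>(permutations_of_set T \<times> words k j) \<times> sorted_words k (n - j).
        ?w (T, (us, ws), vs)) =
      (\<Sum>a\<in>permutations_of_set T \<times> words k j. \<Sum>vs\<in>sorted_words k (n - j).
        cross_weight p q T ({..<n} - T) * p ^ ((n - j) choose 2) *
          ((case a of (us, ws) \<Rightarrow> list_weight p q r x us ws) * r ^ sum_list vs))"
      by (simp add: sum.cartesian_product case_prod_beta mult_ac)
    also have "\<dots> = cross_weight p q T ({..<n} - T) * p ^ ((n - j) choose 2) *
        ((\<Sum>(us, ws)\<in>permutations_of_set T \<times> words k j. list_weight p q r x us ws) *
          (\<Sum>vs\<in>sorted_words k (n - j). r ^ sum_list vs))"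
      by (subst sum_product) (simp only: sum_distrib_left)
    finally show "(\<Sum>((us, ws), vs)\<in>(permutations_of_set T \<times> words k j) \<times> sorted_words k (n - j).
      ?w (T, (us, ws), vs)) = cross_weight p q T ({..<n} - T) * (p ^ ((n - j) choose 2) *
      (\<Sum>ws\<in>sorted_words k (n - j). r ^ sum_list ws) * wreath_sum p q r x k {..<j})"
      unfolding W by (simp only: mult_ac)
  qed
  also have "\<dots> = pq_binom p q j (n - j) * (p ^ ((n - j) choose 2) *
      (\<Sum>ws\<in>sorted_words k (n - j). r ^ sum_list ws) * wreath_sum p q r x k {..<j})"
    using sum_cross_weight[OF nz, of j "n - j"] assms(1) by (simp add: sum_distrib_right[symmetric])
  finally show ?thesis by (simp add: mult_ac)
qed

text \<open>Sum \<open>list_weight_runs\<close> over all pairs and exchange the sums, so that each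
  cut \<open>j\<close> is handled by \<open>tail_sorted_sum\<close>. For \<open>n = 0\<close> the
  right side would be an empty sum, while the left side is 1.\<close>

lemma wreath_sum_recurrence:
  fixes p q r x :: "'a::field"
  assumes "n \<ge> 1" and "\<And>n. pq_fact p q n \<noteq> 0" and "\<And>n. pq_fact 1 r n \<noteq> 0"
  shows "wreath_sum p q r x (Suc k) {..<n} = (\<Sum>j<n. (x - 1) ^ (n - 1 - j) *
    (pq_binom p q j (n - j) * p ^ ((n - j) choose 2) * pq_binom 1 r (n - j) k * wreath_sum p q r x (Suc k) {..<j}))"
proof -
  let ?X = "permutations_of_set {..<n} \<times> words (Suc k) n"
  let ?w = "\<lambda>j us ws. q ^ rel_pairs (>) us * p ^ rel_pairs (<) us * r ^ sum_list ws * x ^ list_ris (take j us) (take j ws)"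
  have "wreath_sum p q r x (Suc k) {..<n} = (\<Sum>(us, ws)\<in>?X. list_weight p q r x us ws)"
    by (simp add: wreath_sum_def)
  also have "\<dots> = (\<Sum>(us, ws)\<in>?X. \<Sum>j<n. if sorted_wrt (<) (drop j us) \<and> sorted (drop j ws)
       then (x - 1) ^ (n - 1 - j) * ?w j us ws else 0)"
    using assms(1) length_finite_permutations_of_set[of _ "{..<n}"]
    by (intro sum.cong refl) (auto simp: words_def intro!: list_weight_runs)
  also have "\<dots> = (\<Sum>j<n. \<Sum>(us, ws)\<in>?X. if sorted_wrt (<) (drop j us) \<and> sorted (drop j ws)
       then (x - 1) ^ (n - 1 - j) * ?w j us ws else 0)"
    unfolding case_prod_beta by (rule sum.swap)
  also have "\<dots> = (\<Sum>j<n. \<Sum>(us, ws)\<in>tail_sorted_pairs (Suc k) n j. (x - 1) ^ (n - 1 - j) * ?w j us ws)"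
    by (rule sum.cong[OF refl], rule sum.mono_neutral_cong_right) (auto simp: tail_sorted_pairs_def split: if_splits)
  also have "\<dots> = (\<Sum>j<n. (x - 1) ^ (n - 1 - j) * (\<Sum>(us, ws)\<in>tail_sorted_pairs (Suc k) n j. ?w j us ws))"
    by (simp add: sum_distrib_left case_prod_beta)
  finally show ?thesis
    using assms by (simp add: tail_sorted_sum sum_sorted_words)
qed

section \<open>Translation of wreath product elements into pairs of lists\<close>

lemma rel_pairs_snoc: "rel_pairs R (us @ [v]) = rel_pairs R us + length (filter (\<lambda>u. R u v) us)"
  by (induction us) auto

text \<open>The interval list grows at its back, so the induction splits off the pairs whose second
  index is \<open>Suc n\<close>.\<close>

lemma rel_pairs_map_upt:
  "rel_pairs R (map \<sigma> [1..<Suc n]) =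
    card {(i, j). i \<in> {1..n} \<and> j \<in> {1..n} \<and> i < j \<and> R (\<sigma> i) (\<sigma> j)}"
proof (induction n)
  case 0
  show ?case by simp
next
  case (Suc n)
  let ?A = "{(i, j). i \<in> {1..n} \<and> j \<in> {1..n} \<and> i < j \<and> R (\<sigma> i) (\<sigma> j)}"
  let ?B = "{i\<in>{1..n}. R (\<sigma> i) (\<sigma> (Suc n))}"
  have "{(i, j). i \<in> {1..Suc n} \<and> j \<in> {1..Suc n} \<and> i < j \<and> R (\<sigma> i) (\<sigma> j)} = ?A \<union> (\<lambda>i. (i, Suc n)) ` ?B"
    by (auto simp: le_Suc_eq)
  moreover have "finite ?A" by (rule finite_subset[of _ "{1..n} \<times> {1..n}"]) auto
  moreover have "?A \<inter> (\<lambda>i. (i, Suc n)) ` ?B = {}" by auto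
  moreover have "card ((\<lambda>i. (i, Suc n)) ` ?B) = card ?B" by (rule card_image) (auto simp: inj_on_def)
  ultimately have "card {(i, j). i \<in> {1..Suc n} \<and> j \<in> {1..Suc n} \<and> i < j \<and> R (\<sigma> i) (\<sigma> j)} = card ?A + card ?B"
    by (simp add: card_Un_disjoint)
  moreover have "length (filter (\<lambda>u. R u (\<sigma> (Suc n))) (map \<sigma> [1..<Suc n])) = card ?B"
    by (auto simp: filter_map o_def distinct_length_filter simp del: upt_Suc intro!: arg_cong[where f = card])
  moreover have "map \<sigma> [1..<Suc (Suc n)] = map \<sigma> [1..<Suc n] @ [\<sigma> (Suc n)]" by simp
  ultimately show ?case using Suc by (simp only: rel_pairs_snoc)
qed

lemma list_ris_map_upt: "list_ris (map \<sigma> [1..<Suc n]) (map w [1..<Suc n]) = ris n \<sigma> w"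
proof -
  \<comment> \<open>List positions start at 0 and those of \<open>ris\<close> at 1, hence the shift
    by \<open>Suc\<close>.\<close>
  have "{i. 1 \<le> i \<and> i < n \<and> \<sigma> i < \<sigma> (i + 1) \<and> w i \<le> w (i + 1)} =
      Suc ` {i. Suc i < n \<and> \<sigma> (Suc i) < \<sigma> (Suc (Suc i)) \<and> w (Suc i) \<le> w (Suc (Suc i))}"
  proof (intro equalityI subsetI)
    fix i assume "i \<in> {i. 1 \<le> i \<and> i < n \<and> \<sigma> i < \<sigma> (i + 1) \<and> w i \<le> w (i + 1)}"
    then show "i \<in> Suc ` {i. Suc i < n \<and> \<sigma> (Suc i) < \<sigma> (Suc (Suc i)) \<and> w (Suc i) \<le> w (Suc (Suc i))}"
      by (cases i) auto
  qed auto
  then show ?thesis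
    by (simp add: list_ris_def ris_def card_image del: upt_Suc cong: conj_cong)
qed

text \<open>One-line notation maps \<open>wreath k n\<close> bijectively onto pairs of lists and
  preserves all four statistics; the values are then moved from \<open>{1..n}\<close> to
  \<open>{..<n}\<close>.\<close>

lemma wreath_sum_eq:
  fixes p q r x :: "'a::field"
  shows "(\<Sum>(\<sigma>, w)\<in>wreath k n. q ^ invs n \<sigma> * p ^ coinvs n \<sigma> * r ^ wt n w * x ^ ris n \<sigma> w) =
    wreath_sum p q r x k {..<n}"
proof -
  let ?L = "\<lambda>f :: nat \<Rightarrow> nat. map f [1..<Suc n]"
  let ?f = "\<lambda>(\<sigma>, w). (?L \<sigma>, ?L w)"
  let ?Y = "permutations_of_set {1..n} \<times> words k n"
  have set_upt: "set [1..<Suc n] = {1..n}" by auto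
  have L_eq: "?L f = ?L g \<longleftrightarrow> (\<forall>i\<in>{1..n}. f i = g i)" for f g
    by (simp only: map_eq_conv set_upt)
  have inj: "inj_on ?f (wreath k n)"
  proof (rule inj_onI, clarify)
    fix \<sigma> w \<sigma>' w' assume in1: "(\<sigma>, w) \<in> wreath k n" and in2: "(\<sigma>', w') \<in> wreath k n"
      and eq: "?L \<sigma> = ?L \<sigma>'" "?L w = ?L w'"
    \<comment> \<open>The lists record values on \<open>{1..n}\<close> only. Elsewhere a permutation
      is the identity and a word is \<open>undefined\<close>, so nothing is lost.\<close>
    have "\<sigma> i = \<sigma>' i" for i
      using in1 in2 eq(1) unfolding L_eq wreath_def by (cases "i \<in> {1..n}") (auto simp: permutes_def)
    moreover have "w = w'"
      using in1 in2 eq(2) unfolding L_eq wreath_def by (auto intro: PiE_ext)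
    ultimately show "\<sigma> = \<sigma>' \<and> w = w'" by auto
  qed
  have "?f ` wreath k n \<subseteq> ?Y"
  proof (clarify)
    fix \<sigma> w assume *: "(\<sigma>, w) \<in> wreath k n"
    then have \<sigma>: "\<sigma> permutes {1..n}" and w: "w \<in> {1..n} \<rightarrow>\<^sub>E {0..<k}" by (auto simp: wreath_def)
    have "set (?L \<sigma>) = {1..n}" using permutes_image[OF \<sigma>] by (simp only: set_map set_upt)
    moreover have "distinct (?L \<sigma>)"
      using permutes_inj_on[OF \<sigma>] by (simp add: distinct_map del: upt_Suc)
    moreover have "set (?L w) \<subseteq> {..<k}" using w unfolding set_map set_upt by auto
    ultimately show "?L \<sigma> \<in> permutations_of_set {1..n} \<and> ?L w \<in> words k n"
      by (auto simp: permutations_of_set_def words_def)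
  qed
  moreover have "card (words k n) = k ^ n"
    using card_lists_length_eq[of "{..<k}" n] by (simp add: words_def)
  \<comment> \<open>Both sides are \<open>fact n * k ^ n\<close>, so injectivity already gives
    surjectivity.\<close>
  then have "card ?Y = card (wreath k n)"
    by (simp add: wreath_def card_cartesian_product card_permutations card_PiE)
  ultimately have img: "?f ` wreath k n = ?Y"
    using inj by (intro card_subset_eq) (auto simp: card_image)
  have "sum_list (?L w) = wt n w" for w
    unfolding wt_def using sum_set_upt_conv_sum_list_nat[of w 1 "Suc n"]
    by (simp add: atLeastLessThanSuc_atLeastAtMost del: upt_Suc)
  then have weight: "list_weight p q r x (?L \<sigma>) (?L w) = q ^ invs n \<sigma> * p ^ coinvs n \<sigma> * r ^ wt n w * x ^ ris n \<sigma> w" for \<sigma> w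
    by (simp only: list_weight_def rel_pairs_map_upt list_ris_map_upt invs_def coinvs_def)
  have "wreath_sum p q r x k {..<n} = wreath_sum p q r x k {1..n}"
    using wreath_sum_card[of "{1..n}" p q r x k] by simp
  also have "\<dots> = (\<Sum>(us, ws)\<in>?f ` wreath k n. list_weight p q r x us ws)"
    unfolding img by (simp add: wreath_sum_def)
  also have "\<dots> = (\<Sum>a\<in>wreath k n. case ?f a of (us, ws) \<Rightarrow> list_weight p q r x us ws)"
    by (simp only: sum.reindex[OF inj] o_def)
  also have "\<dots> = (\<Sum>(\<sigma>, w)\<in>wreath k n. q ^ invs n \<sigma> * p ^ coinvs n \<sigma> * r ^ wt n w * x ^ ris n \<sigma> w)"
    by (rule sum.cong) (auto simp only: weight split: prod.splits)
  finally show ?thesis ..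
qed

section \<open>Nonvanishing of the factorials in the coefficient field\<close>

lemma Fract_power: "Fract a 1 ^ n = Fract (a ^ n) 1"
  by (induction n) (auto simp: One_fract_def)

lemma X_power_neq_const: "n \<ge> 1 \<Longrightarrow> [:0, 1:] ^ n \<noteq> [:c :: 'a::idom:]"
  using degree_power_eq[of "[:0, 1 :: 'a:]" n] by auto

text \<open>The case \<open>n = 1\<close> of the assumption gives \<open>p\<close> different from
  \<open>q\<close>, so the quotient formula \<open>pq_int_eq\<close> applies to every
  factor.\<close>

lemma pq_fact_nonzero:
  assumes "\<And>n. n \<ge> 1 \<Longrightarrow> p ^ n \<noteq> q ^ n"
  shows "pq_fact p q n \<noteq> 0"
  using assms assms[of 1] by (simp add: pq_fact_def pq_int_eq)

lemma pq_fact_var_nonzero: "pq_fact var_p var_q n \<noteq> 0"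
proof (rule pq_fact_nonzero)
  fix n :: nat assume "n \<ge> 1"
  then show "var_p ^ n \<noteq> var_q ^ n"
    \<comment> \<open>In the polynomial layer of \<open>var_q\<close>, powers of
      \<open>var_p\<close> are constants, because \<open>var_p\<close> lives one layer further
      in.\<close>
    using X_power_neq_const[of n "[:0, 1:] ^ n :: rat poly"]
    by (auto simp: var_p_def var_q_def Fract_power eq_fract poly_const_pow)
qed

lemma r_fact_var_nonzero: "pq_fact 1 var_r n \<noteq> 0"
proof (rule pq_fact_nonzero)
  fix n :: nat assume "n \<ge> 1"
  then have "[:0, 1:] ^ n \<noteq> (1 :: rat poly poly poly)"
    using X_power_neq_const[of n "1 :: rat poly poly"] by (metis one_pCons)
  then have "[:[:0, 1:]:] ^ n \<noteq> (1 :: rat poly poly poly poly)"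
    unfolding poly_const_pow by (metis one_pCons pCons_eq_iff)
  then show "1 ^ n \<noteq> var_r ^ n"
    by (simp add: var_r_def Fract_power eq_fract One_fract_def)
qed

lemma var_x_neq_1: "var_x \<noteq> 1"
  by (simp add: var_x_def One_fract_def eq_fract one_pCons)

section \<open>The generating function\<close>

text \<open>For \<open>n > 0\<close> the recurrence says that the convolution with the second series
  is \<open>x - 1\<close> times the coefficient of the first, which cancels the contribution of
  \<open>1 - x\<close>.\<close>

lemma wreath_sum_fps:
  fixes p q r x :: "'a::field"
  assumes nz: "\<And>n. pq_fact p q n \<noteq> 0" "\<And>n. pq_fact 1 r n \<noteq> 0"
  shows "Abs_fps (\<lambda>n. wreath_sum p q r x (Suc k) {..<n} / pq_fact p q n) *
    (fps_const (1 - x) + Abs_fps (\<lambda>n. if n \<ge> 1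
       then p ^ (n choose 2) * (x - 1) ^ n / pq_fact p q n * pq_binom 1 r n k else 0)) = fps_const (1 - x)"
    (is "?A * (_ + ?B) = _")
proof (rule fps_ext)
  fix n
  let ?W = "\<lambda>n. wreath_sum p q r x (Suc k) {..<n}"
  show "(?A * (fps_const (1 - x) + ?B)) $ n = fps_const (1 - x) $ n"
  proof (cases "n = 0")
    case True
    have "words (Suc k) 0 = {[]}" by (auto simp: words_def)
    then have "?W 0 = 1"
      by (simp add: wreath_sum_def list_weight_def list_ris_def)
    with True show ?thesis by simp
  next
    case False
    have "(?A * ?B) $ n = (\<Sum>j\<le>n. ?A $ j * ?B $ (n - j))"
      by (simp add: fps_mult_nth atLeast0AtMost)
    \<comment> \<open>The term \<open>j = n\<close> vanishes since \<open>?B\<close> has constant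
      coefficient 0.\<close>
    also have "\<dots> = (\<Sum>j<n. ?A $ j * ?B $ (n - j))"
      by (intro sum.mono_neutral_right) auto
    also have "\<dots> = (\<Sum>j<n. (x - 1) / pq_fact p q n * ((x - 1) ^ (n - 1 - j) *
        (pq_binom p q j (n - j) * p ^ ((n - j) choose 2) * pq_binom 1 r (n - j) k * ?W j)))"
    \<comment> \<open>The recurrence carries \<open>(x - 1) ^ (n - 1 - j)\<close>, one power less
      than \<open>?B\<close>, so a factor \<open>x - 1\<close> comes out; the two factorials in the
      denominators combine into \<open>pq_binom p q j (n - j)\<close> over
      \<open>pq_fact p q n\<close>.\<close>
    proof (intro sum.cong refl)
      fix j assume "j \<in> {..<n}"
      then have j: "j < n" by simp
      then have "n - j = Suc (n - 1 - j)" by simp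
      then have "(x - 1) ^ (n - j) = (x - 1) * (x - 1) ^ (n - 1 - j)" by (simp only: power_Suc)
      moreover have "pq_binom p q j (n - j) = pq_fact p q n / (pq_fact p q j * pq_fact p q (n - j))"
        using j by (simp add: pq_binom_def)
      ultimately show "?A $ j * ?B $ (n - j) = (x - 1) / pq_fact p q n * ((x - 1) ^ (n - 1 - j) *
        (pq_binom p q j (n - j) * p ^ ((n - j) choose 2) * pq_binom 1 r (n - j) k * ?W j))"
        using j nz(1)[of n] by (simp add: Suc_le_eq mult_ac)
    qed
    also have "\<dots> = (x - 1) / pq_fact p q n * ?W n"
      using wreath_sum_recurrence[of n p q r x k, OF _ nz] False by (simp only: sum_distrib_left[symmetric])
    finally have "(?A * ?B) $ n = (x - 1) / pq_fact p q n * ?W n" .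
    then show ?thesis using False
      by (simp add: algebra_simps diff_divide_distrib)
  qed
qed

theorem theorem5:
  fixes k :: nat
  assumes "k \<ge> 2"
  shows "Abs_fps (\<lambda>n. (1 / pq_fact var_p var_q n) *
             (\<Sum>(\<sigma>, w)\<in>wreath k n. var_q ^ invs n \<sigma> * var_p ^ coinvs n \<sigma> * var_r ^ wt n w * var_x ^ ris n \<sigma> w))
       = fps_const (1 - var_x) /
           (fps_const (1 - var_x) +
            Abs_fps (\<lambda>n. if n \<ge> 1
                         then var_p ^ (n choose 2) * (var_x - 1) ^ n / pq_fact var_p var_q n * r_binomial var_r (n + k - 1) n
                         else 0))"
proof -
  \<comment> \<open>With \<open>k = Suc k'\<close> the upper index \<open>n + k - 1\<close> becomes
    \<open>n + k'\<close>, the form in which \<open>pq_binom\<close> counts sorted words.\<close>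
  obtain k' where k: "k = Suc k'" using assms by (cases k) auto
  let ?A = "Abs_fps (\<lambda>n. wreath_sum var_p var_q var_r var_x k {..<n} / pq_fact var_p var_q n)"
  let ?D = "fps_const (1 - var_x) + Abs_fps (\<lambda>n. if n \<ge> 1
      then var_p ^ (n choose 2) * (var_x - 1) ^ n / pq_fact var_p var_q n * r_binomial var_r (n + k - 1) n else 0)"
  have "r_binomial var_r (n + k - 1) n = pq_binom 1 var_r n k'" for n
    by (simp add: k r_binomial_def r_fact_def pq_binom_def)
  then have AD: "?A * ?D = fps_const (1 - var_x)"
    using wreath_sum_fps[OF pq_fact_var_nonzero r_fact_var_nonzero, of var_x k'] by (simp only: k)
  \<comment> \<open>The constant coefficient of \<open>?D\<close> is \<open>1 - var_x\<close>; it is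
    nonzero, so \<open>?D\<close> can be cancelled.\<close>
  have "?D $ 0 \<noteq> 0" using var_x_neq_1 by simp
  then have D: "?D \<noteq> 0" by (metis fps_zero_nth)
  have "?A = fps_const (1 - var_x) / ?D"
    using nonzero_mult_div_cancel_right[OF D, of ?A] unfolding AD by (rule sym)
  then show ?thesis by (simp add: wreath_sum_eq)
qed

end
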